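(* Let $m,n\ge 1$ be integers and let $r=2^m$, $s=2^n$. Then the pair $(r,s)$ is BC-compatible, i.e. there exists $c\in\mathbb{F}_{r^2}$ such that the polynomial $y^{s+1}+c\,y^s+c^r y+1$ (in the variable $y$) has no roots $y$ belonging to $\mu_{r+1}$, if and only if $m>1$ and $n/m$ is not an odd integer.
   Context: $\mathbb{F}_q$ denotes the finite field with $q$ elements. For a positive integer $N$, $\mu_N$ denotes the group of $N$-th roots of unity in the algebraic closure of $\mathbb{F}_2$. Since $r+1$ divides $r^2-1$, $\mu_{r+1}\subset\mathbb{F}_{r^2}^\times$, so $\mu_{r+1}=\{y\in\mathbb{F}_{r^2}: y^{r+1}=1\}$. For $r=2^m$, $s=2^n$ with $m,n\ge1$, the pair $(r,s)$ is called BC-compatible if there is $c\in\mathbb{F}_{r^2}$ such that $y^{s+1}+c\,y^s+c^r y+1$ has no roots $y$ belonging to $\mu_{r+1}$. *)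

theory Defs
  imports "HOL-Algebra.Algebraic_Closure_Type" "HOL-Library.Z2"
begin

text \<open>
  All finite fields of characteristic 2 are realised inside one fixed algebraic closure
  of the field \<^typ>\<open>bit\<close> with two elements.
\<close>

type_synonym F2_closure = "bit alg_closure"

text \<open>
  The finite field with \<open>q\<close> elements is the unique subfield of cardinality \<open>q\<close>. The description
  is meaningful when \<open>q\<close> is a power of 2 with positive exponent; existence and uniqueness are
  shown in \<open>finite_subfield_iff\<close> below.
\<close>

definition FF :: "nat \<Rightarrow> F2_closure set" where
  "FF q = (THE K. subfield K (ring_of_type_algebra :: F2_closure ring) \<and> card K = q)"

definition roots_of_unity :: "nat \<Rightarrow> F2_closure set" where
  "roots_of_unity N = {y. y ^ N = 1}"

definition BC_poly :: "nat \<Rightarrow> nat \<Rightarrow> F2_closure \<Rightarrow> F2_closure poly" where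
  "BC_poly r s c = Polynomial.monom 1 (s + 1) + Polynomial.monom c s + Polynomial.monom (c ^ r) 1 + 1"

definition BC_compatible :: "nat \<Rightarrow> nat \<Rightarrow> bool" where
  "BC_compatible r s \<longleftrightarrow>
     (\<exists>c\<in>FF (r ^ 2). \<not> (\<exists>y\<in>roots_of_unity (r + 1). poly (BC_poly r s c) y = 0))"

lemma poly_BC_poly: "poly (BC_poly r s c) y = y ^ (s + 1) + c * y ^ s + c ^ r * y + 1"
  by (simp add: BC_poly_def poly_monom)

lemma CHAR_bit: "CHAR(bit) = 2"
proof (rule CHAR_eqI)
  show "of_nat 2 = (0 :: bit)"
    by simp
  have "of_nat n = (if odd n then 1 else 0 :: bit)" for n
    by (induction n) auto
  then show "2 dvd n" if "of_nat n = (0 :: bit)" for n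
    using that by (metis zero_neq_one)
qed

lemma CHAR_F2_closure: "CHAR(F2_closure) = 2"
  by (simp add: CHAR_bit)

lemma F2_closure_add_self: "x + x = (0 :: F2_closure)"
proof -
  have "of_nat 2 = (0 :: F2_closure)"
    by (metis CHAR_F2_closure of_nat_CHAR)
  then show ?thesis
    by (metis mult_2 mult_zero_left of_nat_numeral)
qed

lemma F2_closure_uminus: "- x = (x :: F2_closure)"
  by (metis F2_closure_add_self minus_unique)

lemma F2_closure_add_power: "(x + y :: F2_closure) ^ (2 ^ k) = x ^ (2 ^ k) + y ^ (2 ^ k)"
  by (rule freshmans_dream') (simp_all only: CHAR_F2_closure two_is_prime_nat)

lemma subfield_type_iff:
  fixes K :: "F2_closure set"
  shows "subfield K (ring_of_type_algebra :: F2_closure ring) \<longleftrightarrow>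
    1 \<in> K \<and> (\<forall>x\<in>K. \<forall>y\<in>K. x + y \<in> K \<and> x * y \<in> K) \<and> (\<forall>x\<in>K. inverse x \<in> K)"
    (is "?L \<longleftrightarrow> ?R")
proof -
  define R where "R = (ring_of_type_algebra :: F2_closure ring)"
  interpret R: field R
    unfolding R_def by rule
  have [simp]: "carrier R = UNIV" "\<one>\<^bsub>R\<^esub> = 1" "\<zero>\<^bsub>R\<^esub> = 0"
    "x \<otimes>\<^bsub>R\<^esub> y = x * y" "x \<oplus>\<^bsub>R\<^esub> y = x + y" for x y
    by (simp_all add: R_def ring_of_type_algebra_def)
  have neg: "\<ominus>\<^bsub>R\<^esub> x = x" for x
    using R.minus_equality[of x x] by (simp add: F2_closure_add_self)
  have inv: "inv\<^bsub>R\<^esub> x = inverse x" if "x \<noteq> 0" for x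
    using R.comm_inv_char[of x "inverse x"] that by simp
  show ?thesis
    unfolding R_def[symmetric]
  proof
    assume K: "subfield K R"
    note S = subringE[OF subfieldE(1)[OF K]]
    have "inverse x \<in> K" if "x \<in> K" for x
      using R.subfield_m_inv(1)[OF K, of x] that inv[of x] S(2) by (cases "x = 0") auto
    then show ?R
      using S by auto
  next
    assume ?R
    then show "subfield K R"
      by (intro R.subfieldI' R.subringI) (auto simp: neg inv)
  qed
qed

lemma card_power_fixed:
  assumes "k > 0"
  shows "card {x :: F2_closure. x ^ (2 ^ k) = x} = 2 ^ k"
proof -
  define q :: nat where "q = 2 ^ k"
  have q: "q > 1"
    unfolding q_def using assms by (metis one_less_numeral_iff one_less_power semiring_norm(76))
  define p :: "F2_closure poly" where "p = Polynomial.monom 1 q - Polynomial.monom 1 1"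
  have deg: "degree p = q"
    unfolding p_def diff_conv_add_uminus using q
    by (subst degree_add_eq_left) (auto simp: degree_monom_eq)
  have p0: "p \<noteq> 0"
    using deg q by auto
  have "of_nat q = (0 :: F2_closure)"
    unfolding of_nat_eq_0_iff_char_dvd CHAR_F2_closure q_def using assms by simp
  then have pd: "pderiv p = - 1"
    by (simp add: p_def pderiv_diff pderiv_monom)
  have ord: "count (proots p) x = 1" if x: "poly p x = 0" for x
  proof -
    obtain u where u: "p = [:-x, 1:] * u"
      using x by (metis poly_eq_0_iff_dvd dvdE)
    have "poly (pderiv p) x = poly u x"
      unfolding u pderiv_mult by (simp add: pderiv_pCons)
    then have "poly u x = - 1"
      by (simp add: pd)
    then have "poly u x \<noteq> 0"
      by simp
    then have "count (proots u) x = 0"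
      by (metis count_proots order_0I poly_0)
    moreover have "proots p = {#x#} + proots u"
      using p0 unfolding u by (subst proots_mult) auto
    ultimately show ?thesis
      by simp
  qed
  obtain A where A: "size A = degree p" "p = smult (lead_coeff p) (\<Prod>x\<in>#A. [:-x, 1:])"
    using alg_closed_imp_factorization[OF p0] by blast
  have "proots p = proots (\<Prod>x\<in>#A. [:-x, 1:])"
    by (subst A(2), subst proots_smult) (use p0 in auto)
  also have "\<dots> = A"
  proof (induction A)
    case (add x A)
    have "(\<Prod>x\<in>#A. [:-x, 1:]) \<noteq> 0"
      by (auto simp: prod_mset_zero_iff)
    then have "proots ([:-x, 1:] * (\<Prod>x\<in>#A. [:-x, 1:])) = {#x#} + proots (\<Prod>x\<in>#A. [:-x, 1:])"
      by (subst proots_mult) auto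
    then show ?case
      by (simp add: add.IH del: mult_pCons_left)
  qed simp
  finally have pA: "proots p = A" .
  have "degree p = (\<Sum>x\<in>set_mset (proots p). count (proots p) x)"
    using A(1) pA by (simp add: size_multiset_overloaded_eq)
  also have "\<dots> = (\<Sum>x\<in>{x. poly p x = 0}. 1)"
    using p0 by (intro sum.cong) (simp_all del: count_proots add: ord)
  also have "\<dots> = card {x :: F2_closure. x ^ q = x}"
    by (simp add: p_def poly_monom)
  finally show ?thesis
    using deg by (simp add: q_def)
qed

lemma finite_subfield_iff:
  fixes K :: "F2_closure set"
  assumes "k > 0"
  shows "subfield K (ring_of_type_algebra :: F2_closure ring) \<and> card K = 2 ^ k \<longleftrightarrow>
    K = {x. x ^ (2 ^ k) = x}" (is "?L \<longleftrightarrow> K = ?F")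
proof
  assume "K = ?F"
  then show ?L
    using card_power_fixed[OF assms]
    by (auto simp: subfield_type_iff F2_closure_add_power power_mult_distrib power_inverse)
next
  assume L: ?L
  then have K: "1 \<in> K" "\<And>x y. x \<in> K \<Longrightarrow> y \<in> K \<Longrightarrow> x + y \<in> K \<and> x * y \<in> K"
      "\<And>x. x \<in> K \<Longrightarrow> inverse x \<in> K" and c: "card K = 2 ^ k"
    by (auto simp: subfield_type_iff)
  have fin: "finite K"
    using c card.infinite by force
  have z: "0 \<in> K"
    using K(1) K(2)[of 1 1] F2_closure_add_self[of 1] by simp
  have "x ^ (2 ^ k) = x" if x: "x \<in> K" for x
  proof (cases "x = 0")
    case False
    let ?U = "K - {0}"
    have "bij_betw ((*) x) ?U ?U"
      by (rule bij_betw_byWitness[where f' = "(*) (inverse x)"])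
        (use x False K in \<open>auto simp: mult.assoc[symmetric]\<close>)
    then have "(\<Prod>y\<in>?U. x * y) = \<Prod>?U"
      by (rule prod.reindex_bij_betw)
    then have "x ^ card ?U * \<Prod>?U = \<Prod>?U"
      by (simp add: prod.distrib)
    moreover have "\<Prod>?U \<noteq> 0"
      using fin by simp
    ultimately have "x ^ card ?U = 1"
      by simp
    moreover have "2 ^ k = Suc (card ?U)"
      using c z fin by (metis card.remove)
    ultimately show ?thesis
      by simp
  qed (use assms in auto)
  then have "K \<subseteq> ?F"
    by auto
  moreover have "finite ?F"
    using card_power_fixed[OF assms] card.infinite by force
  ultimately show "K = ?F"
    using card_subset_eq[of ?F K] c card_power_fixed[OF assms] by simp
qed

lemma FF_eq: "k > 0 \<Longrightarrow> FF (2 ^ k) = {x. x ^ (2 ^ k) = x}"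
  unfolding FF_def by (rule the_equality) (simp_all only: finite_subfield_iff)

lemma subfield_FF: "k > 0 \<Longrightarrow> subfield (FF (2 ^ k)) (ring_of_type_algebra :: F2_closure ring)"
  and card_FF: "k > 0 \<Longrightarrow> card (FF (2 ^ k)) = 2 ^ k"
  using finite_subfield_iff[of k "FF (2 ^ k)"] FF_eq[of k] by auto

end

theory Submission
  imports Defs
begin

text \<open>
  Write \<open>f c y\<close> for the value at \<open>y\<close> of the polynomial with parameter \<open>c\<close>. For fixed \<open>y\<close> in
  \<open>\<mu>\<^bsub>r+1\<^esub>\<close>, the parameters \<open>c\<close> with \<open>f c y = 0\<close> form an affine line \<open>L y\<close> over the field with
  \<open>r\<close> elements inside the plane of all \<open>c\<close>, so incompatibility means that these \<open>r + 1\<close> lines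
  cover the plane.

  The line \<open>L 1\<close> is the subfield of order \<open>r\<close>; its translates are the fibres \<open>c\<^sup>r + c = t\<close> of the
  trace. If \<open>r > 2\<close>, some fibre is disjoint from every line parallel to \<open>L 1\<close> (take
  \<open>t = v + 1/v\<close> with \<open>v \<noteq> 0, 1\<close> in the subfield). Its \<open>r\<close> points must be covered by lines that
  meet it in at most one point each, so \<open>L 1\<close> is the only line in its direction, and then no two
  lines meet outside \<open>L 1\<close>. The direction of \<open>L y\<close> is determined by \<open>y\<^bsup>s-1\<^esup>\<close>, which is
  multiplicative, so all directions differ and any two lines meet; hence all lines pass through
  one point \<open>c\<close>. Summing \<open>f c y = 0\<close> over all \<open>y\<close> forces \<open>y\<^bsup>s+1\<^esup> = 1\<close> on \<open>\<mu>\<^bsub>r+1\<^esub>\<close>, which means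
  that \<open>n\<close> is an odd multiple of \<open>m\<close>. Conversely, \<open>y\<^bsup>s+1\<^esup> = 1\<close> reduces \<open>f c y = 0\<close> to
  \<open>y\<^sup>2 = c / c\<^sup>r\<close>, which is solvable in \<open>\<mu>\<^bsub>r+1\<^esub>\<close>.
\<close>

section \<open>Separable polynomials, roots of unity and trace fibres\<close>

text \<open>Splitting off a root \<open>a\<close> as \<open>p = [:-a, 1:] * q\<close> makes
  \<open>pderiv p\<close> agree with \<open>q\<close> at \<open>a\<close>, so \<open>a\<close> is
  not a root of \<open>q\<close>; separability passes to \<open>q\<close>.\<close>

lemma card_roots_separable:
  fixes p :: "'a :: alg_closed_field poly"
  assumes "p \<noteq> 0" and sep: "\<And>x. poly p x = 0 \<Longrightarrow> poly (pderiv p) x \<noteq> 0"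
  shows "card {x. poly p x = 0} = degree p"
  using assms
proof (induction "degree p" arbitrary: p)
  case 0
  then obtain a where "p = [:a:]" "a \<noteq> 0"
    by (metis degree_0_id degree_eq_zeroE pCons_eq_0_iff)
  then show ?case by simp
next
  case (Suc d)
  obtain a where a: "poly p a = 0"
    using alg_closed_imp_poly_has_root[of p] Suc.hyps(2) by auto
  then obtain q where q: "p = [:-a, 1:] * q"
    by (metis poly_eq_0_iff_dvd dvdE)
  have der: "poly (pderiv p) x = (x - a) * poly (pderiv q) x + poly q x" for x
    unfolding q pderiv_mult by (simp add: pderiv_pCons algebra_simps)
  have q0: "q \<noteq> 0" and deg: "degree p = Suc (degree q)"
    using Suc.prems(1) unfolding q by (auto simp: degree_mult_eq simp del: mult_pCons_left)
  have "poly (pderiv q) x \<noteq> 0" if "poly q x = 0" for x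
    using Suc.prems(2)[of x] that der[of x] by (auto simp: q)
  then have IH: "card {x. poly q x = 0} = degree q"
    using Suc.hyps q0 deg by simp
  have "poly q a \<noteq> 0"
    using Suc.prems(2)[OF a] der[of a] by simp
  moreover have "{x. poly p x = 0} = insert a {x. poly q x = 0}"
    by (auto simp: q)
  ultimately show ?case
    using IH deg poly_roots_finite[OF q0] by simp
qed

lemma F2_closure_add_eq_0_iff: "x + y = 0 \<longleftrightarrow> x = (y :: F2_closure)"
  by (metis F2_closure_uminus add_eq_0_iff)

lemma F2_closure_double: "2 * x = (0 :: F2_closure)"
  by (metis F2_closure_add_self mult_2)

lemma F2_closure_of_nat_two_power: "k \<ge> 1 \<Longrightarrow> of_nat (2 ^ k) = (0 :: F2_closure)"
  unfolding of_nat_eq_0_iff_char_dvd CHAR_F2_closure by simp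

lemma finite_roots_of_unity: "k \<ge> 1 \<Longrightarrow> finite (roots_of_unity k)"
  and card_roots_of_unity_le: "k \<ge> 1 \<Longrightarrow> card (roots_of_unity k) \<le> k"
proof -
  assume k: "k \<ge> 1"
  let ?p = "Polynomial.monom 1 k + 1 :: F2_closure poly"
  have deg: "degree ?p = k"
    using k by (subst degree_add_eq_left) (auto simp: degree_monom_eq)
  then have p0: "?p \<noteq> 0"
    using k by auto
  have eq: "roots_of_unity k = {x. poly ?p x = 0}"
    by (auto simp: roots_of_unity_def poly_monom F2_closure_add_eq_0_iff)
  show "finite (roots_of_unity k)" "card (roots_of_unity k) \<le> k"
    using poly_roots_finite[OF p0] card_poly_roots_bound[OF p0] unfolding eq deg by auto
qed

lemma card_roots_of_unity:
  assumes "k \<ge> 1"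
  shows "card (roots_of_unity (2 ^ k + 1)) = 2 ^ k + 1"
proof -
  let ?p = "Polynomial.monom 1 (2 ^ k + 1) + 1 :: F2_closure poly"
  have deg: "degree ?p = 2 ^ k + 1"
    by (subst degree_add_eq_left) (auto simp: degree_monom_eq)
  have der: "pderiv ?p = Polynomial.monom 1 (2 ^ k)"
    using F2_closure_of_nat_two_power[OF assms] by (simp add: pderiv_add pderiv_monom)
  have "poly (pderiv ?p) x \<noteq> 0" if "poly ?p x = 0" for x
    using that unfolding der by (auto simp: poly_monom)
  then have "card {x. poly ?p x = 0} = degree ?p"
    using deg by (intro card_roots_separable) auto
  moreover have "roots_of_unity (2 ^ k + 1) = {x. poly ?p x = 0}"
    by (auto simp: roots_of_unity_def poly_monom F2_closure_add_eq_0_iff)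
  ultimately show ?thesis
    using deg by simp
qed

lemma card_trace_fibre:
  fixes t :: F2_closure
  assumes "k \<ge> 1"
  shows "card {c. c ^ (2 ^ k) + c = t} = 2 ^ k"
proof -
  let ?p = "Polynomial.monom 1 (2 ^ k) + [:t, 1:]"
  have "(1::nat) < 2 ^ k"
    using assms by (metis one_less_numeral_iff one_less_power less_eq_Suc_le One_nat_def semiring_norm(76))
  then have deg: "degree ?p = 2 ^ k"
    by (subst degree_add_eq_left) (auto simp: degree_monom_eq)
  have der: "pderiv ?p = 1"
    using F2_closure_of_nat_two_power[OF assms]
    by (simp add: pderiv_add pderiv_monom pderiv_pCons one_pCons del: of_nat_power)
  have "card {x. poly ?p x = 0} = degree ?p"
    using deg der by (intro card_roots_separable) auto
  moreover have "poly ?p c = 0 \<longleftrightarrow> c ^ (2 ^ k) + c = t" for c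
    using F2_closure_add_eq_0_iff[of "c ^ (2 ^ k) + c" t] by (simp add: poly_monom ac_simps)
  ultimately show ?thesis
    using deg by simp
qed

text \<open>Multiplication by \<open>z\<close> permutes the group and scales the sum by
  \<open>z ^ k\<close>.\<close>

lemma sum_roots_of_unity_power:
  assumes "N > 0" and "z \<in> roots_of_unity N" and "z ^ k \<noteq> 1"
  shows "(\<Sum>y\<in>roots_of_unity N. y ^ k) = 0"
proof -
  have "z \<noteq> 0"
    using assms(1,2) by (auto simp: roots_of_unity_def power_0_left)
  then have "bij_betw ((*) z) (roots_of_unity N) (roots_of_unity N)"
    using assms(2)
    by (intro bij_betw_byWitness[where f' = "(*) (inverse z)"])
      (auto simp: roots_of_unity_def power_mult_distrib power_inverse)
  then have "(\<Sum>y\<in>roots_of_unity N. (z * y) ^ k) = (\<Sum>y\<in>roots_of_unity N. y ^ k)"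
    by (rule sum.reindex_bij_betw)
  then have "z ^ k * (\<Sum>y\<in>roots_of_unity N. y ^ k) = (\<Sum>y\<in>roots_of_unity N. y ^ k)"
    by (simp add: power_mult_distrib sum_distrib_left)
  then show ?thesis
    using assms(3) by simp
qed

section \<open>The group \<open>\<mu>\<close> and the trace fibres\<close>

context
  fixes m n r s :: nat
  assumes m: "m \<ge> 1" and n: "n \<ge> 1" and r: "r = 2 ^ m" and s: "s = 2 ^ n"
begin

abbreviation \<mu> :: "F2_closure set" where
  "\<mu> \<equiv> roots_of_unity (r + 1)"

abbreviation f :: "F2_closure \<Rightarrow> F2_closure \<Rightarrow> F2_closure" where
  "f c y \<equiv> y ^ (s + 1) + c * y ^ s + c ^ r * y + 1"

lemma mem_FF_r2: "c \<in> FF (r ^ 2) \<longleftrightarrow> (c ^ r) ^ r = c"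
proof -
  have "FF (r ^ 2) = {c. c ^ r ^ 2 = c}"
    using FF_eq[of "m * 2"] m by (simp add: r power_mult)
  then show ?thesis
    by (simp add: power2_eq_square power_mult)
qed

lemma BC_compatible_iff: "BC_compatible r s \<longleftrightarrow> (\<exists>c. (c ^ r) ^ r = c \<and> (\<forall>y\<in>\<mu>. f c y \<noteq> 0))"
  unfolding BC_compatible_def Bex_def mem_FF_r2 poly_BC_poly by blast

lemma frob_r: "(x + y :: F2_closure) ^ r = x ^ r + y ^ r"
  unfolding r by (rule F2_closure_add_power)

lemma frob_s: "(x + y :: F2_closure) ^ s = x ^ s + y ^ s"
  unfolding s by (rule F2_closure_add_power)

lemma r_ge: "r \<ge> 2"
  unfolding r using m self_le_power[of 2 m] by simp

lemma mu_nonzero: "y \<in> \<mu> \<Longrightarrow> y \<noteq> 0"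
  by (auto simp: roots_of_unity_def)

lemma mu_conj: "y \<in> \<mu> \<Longrightarrow> y ^ r = inverse y"
  by (metis Suc_eq_plus1 inverse_unique mem_Collect_eq power_Suc roots_of_unity_def)

lemma one_mu: "1 \<in> \<mu>"
  by (simp add: roots_of_unity_def)

lemma mu_divide: "x \<in> \<mu> \<Longrightarrow> y \<in> \<mu> \<Longrightarrow> x / y \<in> \<mu>"
  unfolding roots_of_unity_def mem_Collect_eq power_divide by simp

lemma card_mu: "card \<mu> = r + 1" and finite_mu: "finite \<mu>"
  unfolding r by (rule card_roots_of_unity[OF m], rule finite_roots_of_unity) simp

lemma mu_nontrivial: obtains w where "w \<in> \<mu>" "w \<noteq> 1"
proof -
  have "card {1 :: F2_closure} < card \<mu>"
    using card_mu r_ge by simp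
  then have "\<not> \<mu> \<subseteq> {1}"
    by (meson card_mono finite.emptyI finite.insertI leD)
  then show thesis
    using that by blast
qed

lemma trace_fibre_subset:
  assumes "t ^ r = t" and "c ^ r + c = (t :: F2_closure)"
  shows "(c ^ r) ^ r = c"
proof -
  have c: "c ^ r = c + t"
    using assms(2) by (metis F2_closure_add_eq_0_iff add.assoc add.commute)
  then show ?thesis
    using assms(1) by (simp add: frob_r add.assoc F2_closure_add_self)
qed

text \<open>On a trace fibre \<open>c ^ r\<close> is \<open>t - c\<close>, so \<open>f c y\<close>
  is affine in \<open>c\<close> with slope \<open>y ^ s - y\<close>. For \<open>y\<close> in
  \<open>\<mu>\<close> the slope vanishes exactly when the line of \<open>y\<close> is parallel to
  that of \<open>1\<close>.\<close>

lemma root_unique_on_trace_fibre: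
  assumes "y ^ s \<noteq> y" and "c ^ r + c = t" and "c' ^ r + c' = t" and "f c y = 0" and "f c' y = 0"
  shows "c = c'"
proof -
  have e: "c ^ r = t - c" "c' ^ r = t - c'"
    using assms(2,3) by (simp_all add: algebra_simps)
  have "(c - c') * (y ^ s - y) = f c y - f c' y"
    unfolding e by (simp add: algebra_simps)
  also have "\<dots> = 0"
    by (simp only: assms(4,5) diff_self)
  finally have "(c - c') * (y ^ s - y) = 0" .
  then show ?thesis
    using assms(1) by simp
qed

section \<open>Consequences of the lines covering the plane\<close>

context
  assumes cover: "\<And>c. (c ^ r) ^ r = c \<Longrightarrow> \<exists>y\<in>\<mu>. f c y = 0"
begin

text \<open>Assumption \<open>par\<close> keeps the lines parallel to that of \<open>1\<close> off
  the fibre; each remaining line covers at most one of its points.\<close>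

lemma root_choice_on_trace_fibre:
  assumes t: "t ^ r = t" and par: "\<And>c y. c ^ r + c = t \<Longrightarrow> y \<in> \<mu> \<Longrightarrow> y ^ s = y \<Longrightarrow> f c y \<noteq> 0"
  obtains g where "inj_on g {c. c ^ r + c = t}" "g ` {c. c ^ r + c = t} \<subseteq> {y \<in> \<mu>. y ^ s \<noteq> y}"
    "\<forall>c. c ^ r + c = t \<longrightarrow> f c (g c) = 0"
proof -
  have "\<exists>y. y \<in> \<mu> \<and> f c y = 0" if "c ^ r + c = t" for c
    using cover[of c] trace_fibre_subset[OF t that] by blast
  then obtain g where g: "\<And>c. c ^ r + c = t \<Longrightarrow> g c \<in> \<mu>" "\<And>c. c ^ r + c = t \<Longrightarrow> f c (g c) = 0"
    by metis
  have ne: "g c ^ s \<noteq> g c" if "c ^ r + c = t" for c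
    using par[OF that g(1)[OF that]] g(2)[OF that] by blast
  show thesis
  proof
    show "inj_on g {c. c ^ r + c = t}"
    proof (rule inj_onI)
      fix c d assume "c \<in> {c. c ^ r + c = t}" "d \<in> {c. c ^ r + c = t}" and eq: "g c = g d"
      then have c: "c ^ r + c = t" and d: "d ^ r + d = t" by simp_all
      show "c = d"
        by (rule root_unique_on_trace_fibre[OF ne[OF c] c d g(2)[OF c] g(2)[OF d, folded eq]])
    qed
  qed (use g ne in auto)
qed

text \<open>If \<open>y\<close> were not \<open>1\<close>, at most \<open>r - 1\<close> transverse
  lines would be left to cover the \<open>r\<close> points of a fibre.\<close>

lemma mu_direction_trivial:
  assumes "m > 1" and "y \<in> \<mu>" and "y ^ s = y"
  shows "y = 1"
proof -
  have "card {0, 1 :: F2_closure} < card {x :: F2_closure. x ^ r = x}"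
    using power_increasing[of 2 m "2::nat"] assms(1) card_power_fixed[of m] by (simp add: r)
  then have "\<not> {x :: F2_closure. x ^ r = x} \<subseteq> {0, 1}"
    by (meson card_mono finite.emptyI finite.insertI leD)
  then obtain v :: F2_closure where v: "v ^ r = v" "v \<noteq> 0" "v \<noteq> 1"
    by auto
  \<comment> \<open>On this fibre a parallel line requires \<open>y * y + t * y + 1 = 0\<close>,
    whose roots \<open>v\<close> and \<open>inverse v\<close> lie outside
    \<open>\<mu>\<close>.\<close>
  define t where "t = v + inverse v"
  have "t ^ r = t"
    using v by (simp add: t_def frob_r power_inverse)
  moreover have "f c y \<noteq> 0" if c: "c ^ r + c = t" and y: "y \<in> \<mu>" "y ^ s = y" for c y
  proof
    assume "f c y = 0"
    then have "y * y + t * y + 1 = 0"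
      using c y by (simp add: algebra_simps flip: c)
    moreover have "y * y + t * y + 1 = (y + v) * (y + inverse v)"
      using v by (simp add: t_def algebra_simps)
    ultimately have "y = v \<or> y = inverse v"
      by (simp add: F2_closure_add_eq_0_iff)
    moreover have "y ^ (r + 1) = 1"
      using y by (simp add: roots_of_unity_def)
    ultimately have "v ^ (r + 1) = 1"
      by (metis inverse_1 inverse_inverse_eq power_inverse)
    \<comment> \<open>Since \<open>v ^ r = v\<close>, the previous equation reads
      \<open>v * v = 1\<close>.\<close>
    then have "(v + 1) * (v + 1) = 0"
      using v by (simp add: algebra_simps F2_closure_add_self)
    then show False
      using v by (simp add: F2_closure_add_eq_0_iff)
  qed
  ultimately obtain g where g: "inj_on g {c. c ^ r + c = t}"
      "g ` {c. c ^ r + c = t} \<subseteq> {y \<in> \<mu>. y ^ s \<noteq> y}" "\<forall>c. c ^ r + c = t \<longrightarrow> f c (g c) = 0"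
    by (rule root_choice_on_trace_fibre)
  then have "r \<le> card {y \<in> \<mu>. y ^ s \<noteq> y}"
    using card_inj_on_le[OF g(1,2)] finite_mu card_trace_fibre[OF m, of t] by (simp add: r)
  moreover have "card {y \<in> \<mu>. y ^ s \<noteq> y} \<le> card (\<mu> - {1, y})"
    using assms finite_mu by (intro card_mono) auto
  ultimately have "r \<le> r + 1 - card {1, y}"
    using assms finite_mu one_mu card_mu by (simp add: card_Diff_subset)
  then show ?thesis
    using r_ge by (cases "y = 1") auto
qed

text \<open>The fibre through a point \<open>c\<close> outside the line of \<open>1\<close> has
  \<open>r\<close> points, as many as there are transverse lines. The injective choice of lines is
  then a bijection, so only one of them passes through \<open>c\<close>.\<close>

lemma multiple_root_parameter_fixed:
  assumes m1: "m > 1" and c: "(c ^ r) ^ r = c"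
    and y: "y \<in> \<mu> - {1}" "y' \<in> \<mu> - {1}" "y \<noteq> y'" "f c y = 0" "f c y' = 0"
  shows "c ^ r = c"
proof (rule ccontr)
  assume "c ^ r \<noteq> c"
  define t where "t = c ^ r + c"
  have t: "t ^ r = t" "t \<noteq> 0"
    using c \<open>c ^ r \<noteq> c\<close> by (simp_all add: t_def frob_r F2_closure_add_eq_0_iff add.commute)
  have "f d z \<noteq> 0" if "d ^ r + d = t" "z \<in> \<mu>" "z ^ s = z" for d z
  proof -
    have "z = 1"
      using mu_direction_trivial[OF m1] that by blast
    then have "f d z = t + (1 + 1)"
      using that by (simp add: algebra_simps flip: that(1))
    then show ?thesis
      using t by (metis F2_closure_add_self add_0_right)
  qed
  then obtain g where g: "inj_on g {c. c ^ r + c = t}"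
      "g ` {c. c ^ r + c = t} \<subseteq> {y \<in> \<mu>. y ^ s \<noteq> y}" "\<forall>c. c ^ r + c = t \<longrightarrow> f c (g c) = 0"
    by (rule root_choice_on_trace_fibre[OF t(1)])
  have eq: "{y \<in> \<mu>. y ^ s \<noteq> y} = \<mu> - {1}"
    using mu_direction_trivial[OF m1] by auto
  have "card (g ` {c. c ^ r + c = t}) = card (\<mu> - {1})"
    using card_image[OF g(1)] card_trace_fibre[OF m, of t] card_mu finite_mu one_mu by (simp add: r)
  then have im: "g ` {c. c ^ r + c = t} = \<mu> - {1}"
    using g(2) finite_mu unfolding eq by (intro card_subset_eq) auto
  have "z = g c" if z: "z \<in> \<mu> - {1}" "f c z = 0" for z
  proof -
    obtain d where d: "d ^ r + d = t" "z = g d"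
      using im z(1) by blast
    have "z ^ s \<noteq> z" "f d z = 0"
      using z(1) eq d g(3) by blast+
    then have "d = c"
      using root_unique_on_trace_fibre[OF _ d(1) t_def[symmetric] _ z(2)] by blast
    then show ?thesis
      using d by simp
  qed
  then show False
    using y by metis
qed

text \<open>Cramer's rule for two linear equations in the unknowns \<open>c\<close> and
  \<open>c ^ r\<close>, with determinant \<open>D\<close>. Raising to the power \<open>r\<close>
  exchanges \<open>N / D\<close> and \<open>N' / D\<close>, so the second unknown really is the
  conjugate of the first.\<close>

lemma common_root_parameter:
  assumes y: "y \<in> \<mu>" "y' \<in> \<mu>" and det: "y ^ s * y' \<noteq> y' ^ s * y"
  obtains c where "(c ^ r) ^ r = c" "f c y = 0" "f c y' = 0"
proof -
  define a where "a = y ^ s"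
  define b where "b = y' ^ s"
  define D where "D = a * y' + b * y"
  define N where "N = (a * y + 1) * y' + (b * y' + 1) * y"
  define N' where "N' = (a * y + 1) * b + (b * y' + 1) * a"
  define P where "P = a * b * y * y'"
  have nz: "y \<noteq> 0" "y' \<noteq> 0" "a \<noteq> 0" "b \<noteq> 0" "D \<noteq> 0"
    using y mu_nonzero det by (auto simp: a_def b_def D_def F2_closure_add_eq_0_iff)
  have conj: "y ^ r = inverse y" "y' ^ r = inverse y'" "a ^ r = inverse a" "b ^ r = inverse b"
    using y mu_conj by (simp_all add: a_def b_def power_inverse flip: power_mult)
      (metis mult.commute power_inverse power_mult)+
  have "D ^ r = D / P" "N ^ r = N' / P" "N' ^ r = N / P"
    unfolding D_def N_def N'_def P_def frob_r power_mult_distrib conj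
    using nz by (simp_all add: field_simps)
  moreover have "P \<noteq> 0"
    using nz by (simp add: P_def)
  ultimately have c: "(N / D) ^ r = N' / D" "(N' / D) ^ r = N / D"
    by (simp_all add: power_divide)
  have "f (N / D) y = (D * (a * y + 1) + N * a + N' * y) / D"
    "f (N / D) y' = (D * (b * y' + 1) + N * b + N' * y') / D"
    using nz(5) unfolding c(1) power_add power_one_right a_def[symmetric] b_def[symmetric]
    by (simp_all add: add_divide_distrib distrib_left ac_simps)
  moreover have "D * (a * y + 1) + N * a + N' * y = 2 * ((a * y + 1) * D + a * y * (b * y' + 1))"
    "D * (b * y' + 1) + N * b + N' * y' = 2 * ((b * y' + 1) * D + b * y' * (a * y + 1))"
    by (simp_all add: D_def N_def N'_def algebra_simps)
  ultimately have "f (N / D) y = 0" "f (N / D) y' = 0"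
    by (simp_all only: F2_closure_double div_0)
  then show thesis
    using that[of "N / D"] c by simp
qed

lemma mu_power_Suc_s:
  assumes m1: "m > 1" and z: "z \<in> \<mu>"
  shows "z ^ (s + 1) = 1"
proof (rule ccontr)
  assume z1: "z ^ (s + 1) \<noteq> 1"
  obtain w where w: "w \<in> \<mu>" "w \<noteq> 1"
    by (rule mu_nontrivial)
  have "card {1, w} < card \<mu>"
    using card_mu r_ge w by simp
  then have "\<not> \<mu> \<subseteq> {1, w}"
    by (meson card_mono finite.emptyI finite.insertI leD)
  then obtain w' where w': "w' \<in> \<mu>" "w' \<noteq> 1" "w' \<noteq> w"
    by blast
  have pair: "\<exists>c. c ^ r = c \<and> f c w = 0 \<and> f c y = 0" if y: "y \<in> \<mu>" "y \<noteq> 1" "y \<noteq> w" for y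
  proof -
    have nz: "w \<noteq> 0" "y \<noteq> 0"
      using w y mu_nonzero by auto
    \<comment> \<open>Directions are multiplicative: equal ones for \<open>w\<close> and
      \<open>y\<close> would give \<open>w / y\<close> the direction of \<open>1\<close>.\<close>
    have "(w / y) ^ s \<noteq> w / y"
      using mu_direction_trivial[OF m1 mu_divide[OF w(1) y(1)]] nz y(3) by auto
    then have "w ^ s * y \<noteq> y ^ s * w"
      using nz by (simp add: field_simps)
    with common_root_parameter[OF w(1) y(1)]
    obtain c where "(c ^ r) ^ r = c" "f c w = 0" "f c y = 0"
      by blast
    then show ?thesis
      using multiple_root_parameter_fixed[OF m1, of c w y] w y by blast
  qed
  obtain c where c: "c ^ r = c" "f c w = 0"
    using pair[of w'] w' by blast
  have "w ^ s \<noteq> w"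
    using mu_direction_trivial[OF m1] w by blast
  have root: "f c y = 0" if "y \<in> \<mu>" for y
  proof -
    consider "y = 1" | "y = w" | "y \<noteq> 1" "y \<noteq> w" by blast
    then show ?thesis
    proof cases
      case 1
      then show ?thesis
        using c(1) F2_closure_add_self[of "c + 1"] by (simp add: algebra_simps)
    next
      case 3
      then obtain d where d: "d ^ r = d" "f d w = 0" "f d y = 0"
        using pair[OF \<open>y \<in> \<mu>\<close>] by blast
      \<comment> \<open>Both parameters lie on the fibre of trace \<open>0\<close>, which the line
        of \<open>w\<close> meets at most once.\<close>
      then have "d = c"
        using root_unique_on_trace_fibre[OF \<open>w ^ s \<noteq> w\<close>, of d 0 c] c
        by (simp add: F2_closure_add_self)
      then show ?thesis
        using d by simp
    qed (use c in simp)
  qed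
  have "w ^ s \<noteq> 1"
    using frob_s[of w 1] w(2) by (auto simp: F2_closure_add_self F2_closure_add_eq_0_iff s)
  then have "(\<Sum>y\<in>\<mu>. y ^ s) = 0" "(\<Sum>y\<in>\<mu>. y) = 0" "(\<Sum>y\<in>\<mu>. y ^ (s + 1)) = 0"
    using sum_roots_of_unity_power[OF _ w(1), of s] sum_roots_of_unity_power[OF _ w(1), of 1]
      sum_roots_of_unity_power[OF _ z z1] w(2) by simp_all
  \<comment> \<open>Only the constant term survives; it contributes \<open>r + 1\<close>, which is
    \<open>1\<close> in characteristic 2.\<close>
  then have "(\<Sum>y\<in>\<mu>. f c y) = of_nat (card \<mu>)"
    by (simp add: sum.distrib flip: sum_distrib_left)
  moreover have "of_nat r = (0 :: F2_closure)"
    unfolding r by (rule F2_closure_of_nat_two_power[OF m])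
  ultimately show False
    using root unfolding card_mu by simp
qed

end

section \<open>The residue of \<open>n\<close> modulo \<open>2 * m\<close>\<close>

text \<open>Conjugating twice, that is squaring \<open>2 * m\<close> times, fixes every element of
  \<open>\<mu>\<close>.\<close>

lemma mu_power_s_mod:
  assumes "y \<in> \<mu>"
  shows "y ^ s = y ^ (2 ^ (n mod (2 * m)))"
proof -
  have "(y ^ r) ^ r = y"
    using mu_conj[OF assms] by (simp add: power_inverse)
  then have y: "y ^ (2 ^ (2 * m)) = y"
    by (simp add: r mult_2 power_add power_mult)
  have "y ^ ((2 ^ (2 * m)) ^ k) = y" for k
    by (induction k) (simp_all only: power_0 power_one_right power_Suc[of "2 ^ (2 * m)"] power_mult[of y] y)
  moreover have "s = (2 ^ (2 * m)) ^ (n div (2 * m)) * 2 ^ (n mod (2 * m))"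
    unfolding s power_mult[symmetric] power_add[symmetric] by simp
  ultimately show ?thesis
    by (metis power_mult)
qed

text \<open>Comparing root counts with \<open>r + 1\<close> forces the residue \<open>j\<close> to
  be at least \<open>m\<close>. For \<open>j = m + i\<close>, conjugation turns the identity into
  \<open>y ^ (2 ^ i - 1) = 1\<close>, which has too few solutions unless
  \<open>i = 0\<close>.\<close>

lemma mu_power_Suc_s_iff: "(\<forall>y\<in>\<mu>. y ^ (s + 1) = 1) \<longleftrightarrow> n mod (2 * m) = m"
proof
  assume "n mod (2 * m) = m"
  then have "y ^ s = y ^ r" if "y \<in> \<mu>" for y
    using mu_power_s_mod[OF that] r by simp
  then show "\<forall>y\<in>\<mu>. y ^ (s + 1) = 1"
    by (simp add: roots_of_unity_def)
next
  assume *: "\<forall>y\<in>\<mu>. y ^ (s + 1) = 1"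
  define j where "j = n mod (2 * m)"
  have j: "y ^ (2 ^ j + 1) = 1" if "y \<in> \<mu>" for y
    using bspec[OF * that] mu_power_s_mod[OF that] by (simp add: j_def)
  then have "\<mu> \<subseteq> roots_of_unity (2 ^ j + 1)"
    by (auto simp: roots_of_unity_def)
  then have "r + 1 \<le> 2 ^ j + 1"
    using card_mono[OF finite_roots_of_unity] card_roots_of_unity_le card_mu
    by (metis le_add2 order_trans)
  then have "m \<le> j"
    by (simp add: r)
  then obtain i where i: "j = m + i"
    using le_Suc_ex by blast
  have "i < m"
    using m i mod_less_divisor[of "2 * m" n] by (simp add: j_def)
  have "i = 0"
  proof (rule ccontr)
    assume "i \<noteq> 0"
    then have i1: "(2::nat) \<le> 2 ^ i"
      by (simp add: self_le_power)
    then have i2: "2 ^ i - 1 \<ge> (1::nat)"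
      by linarith
    have "y ^ (2 ^ i - 1) = 1" if "y \<in> \<mu>" for y
    proof -
      have "y ^ (2 ^ j) = inverse (y ^ (2 ^ i))"
        by (simp add: i power_add power_mult mu_conj[OF that, unfolded r] power_inverse)
      then have "y * inverse (y ^ (2 ^ i)) = 1"
        using j[OF that] by simp
      then have "y = y ^ (2 ^ i)"
        using mu_nonzero[OF that] by (simp add: field_simps)
      also have "\<dots> = y * y ^ (2 ^ i - 1)"
        using i1 by (simp flip: power_Suc)
      finally show ?thesis
        using mu_nonzero[OF that] by simp
    qed
    then have "\<mu> \<subseteq> roots_of_unity (2 ^ i - 1)"
      by (auto simp: roots_of_unity_def)
    then have "r + 1 \<le> 2 ^ i - 1"
      using card_mono[OF finite_roots_of_unity[OF i2], of \<mu>] card_roots_of_unity_le[OF i2] card_mu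
      by linarith
    moreover have "(2::nat) ^ i < 2 ^ m"
      using \<open>i < m\<close> by simp
    ultimately show False
      unfolding r by linarith
  qed
  then show "n mod (2 * m) = m"
    using i j_def by simp
qed

section \<open>Explicit roots in the incompatible cases\<close>

lemma root_if_odd_multiple:
  assumes "n mod (2 * m) = m" and c: "(c ^ r) ^ r = c"
  shows "\<exists>y\<in>\<mu>. f c y = 0"
proof (cases "c = 0")
  case True
  then show ?thesis
    using one_mu r_ge by (intro bexI[of _ 1]) (simp_all add: F2_closure_add_self power_0_left del: one_add_one)
next
  case False
  define z where "z = c / c ^ r"
  have "z \<in> \<mu>"
    using False c by (simp add: z_def roots_of_unity_def power_divide)
  \<comment> \<open>The exponent is half of \<open>r + 2\<close>, so \<open>y\<close> is the square
    root of \<open>z\<close> in the group \<open>\<mu>\<close> of odd order.\<close>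
  define y where "y = z ^ (2 ^ (m - 1) + 1)"
  have "(2 ^ (m - 1) + 1) * 2 = r + 1 + 1"
    using m by (cases m) (simp_all add: r)
  then have "y ^ 2 = z ^ (r + 1) * z"
    unfolding y_def power_mult[symmetric] by simp
  then have y2: "y * y * c ^ r = c"
    using \<open>z \<in> \<mu>\<close> False by (simp add: roots_of_unity_def power2_eq_square z_def)
  have y: "y \<in> \<mu>"
    using \<open>z \<in> \<mu>\<close> unfolding y_def roots_of_unity_def mem_Collect_eq
    by (metis mult.commute power_mult power_one)
  have ys: "y ^ (s + 1) = 1"
    using assms(1) mu_power_Suc_s_iff y by blast
  then have "c * y ^ s = c ^ r * y * y ^ (s + 1)"
    by (subst y2[symmetric]) (simp add: ac_simps)
  then have "f c y = (1 + c ^ r * y) + (1 + c ^ r * y)"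
    unfolding ys by (simp add: ac_simps)
  then show ?thesis
    using y F2_closure_add_self by metis
qed

text \<open>For even \<open>n\<close>, \<open>y ^ s = y\<close> on \<open>\<mu>\<close> leaves
  \<open>y * y + u * y + 1\<close> with \<open>u\<close> equal to \<open>0\<close> or
  \<open>1\<close>; a root is \<open>1\<close> or a primitive cube root of unity,
  respectively.\<close>

lemma root_if_m_eq_1:
  assumes "m = 1" and c: "(c ^ r) ^ r = c"
  shows "\<exists>y\<in>\<mu>. f c y = 0"
proof (cases "odd n")
  case True
  then show ?thesis
    using assms by (intro root_if_odd_multiple) (simp_all add: odd_iff_mod_2_eq_one)
next
  case False
  have r2: "r = 2"
    using assms by (simp add: r)
  have f: "f c y = y * y + (c + c ^ r) * y + 1" if "y \<in> \<mu>" for y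
  proof -
    have "y ^ s = y"
      using mu_power_s_mod[OF that] assms False by (simp add: even_iff_mod_2_eq_zero)
    then show ?thesis
      by (simp add: algebra_simps)
  qed
  define u where "u = c + c ^ r"
  have "u * u = u"
    using frob_r[of c "c ^ r"] c by (simp only: u_def r2 power2_eq_square add.commute)
  then have "u = 0 \<or> u = 1"
    by simp
  then show ?thesis
  proof
    assume "u = 0"
    then show ?thesis
      using f[OF one_mu] one_mu by (intro bexI[of _ 1]) (simp_all add: u_def F2_closure_add_self)
  next
    assume u: "u = 1"
    obtain w where w: "w \<in> \<mu>" "w \<noteq> 1"
      by (rule mu_nontrivial)
    have "(w - 1) * (w * w + w + 1) = w ^ (r + 1) - 1"
      by (simp add: r2 algebra_simps power3_eq_cube)
    then have "w * w + w + 1 = 0"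
      using w by (simp add: roots_of_unity_def)
    then show ?thesis
      using f[OF w(1)] w(1) u by (intro bexI[of _ w]) (simp_all add: u_def)
  qed
qed

lemma BC_compatible_iff_mod: "BC_compatible r s \<longleftrightarrow> m > 1 \<and> n mod (2 * m) \<noteq> m"
proof -
  have "m > 1 \<Longrightarrow> n mod (2 * m) \<noteq> m \<Longrightarrow> BC_compatible r s"
    unfolding BC_compatible_iff mu_power_Suc_s_iff[symmetric] using mu_power_Suc_s by blast
  then show ?thesis
    unfolding BC_compatible_iff
    using root_if_odd_multiple root_if_m_eq_1 m by (metis le_neq_implies_less)
qed

end

section \<open>Odd quotients as a residue condition\<close>

lemma odd_quotient_iff_mod:
  fixes m n :: nat
  assumes "m \<ge> 1"
  shows "(\<exists>k :: int. odd k \<and> rat_of_nat n / rat_of_nat m = rat_of_int k) \<longleftrightarrow> n mod (2 * m) = m"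
proof
  assume "\<exists>k :: int. odd k \<and> rat_of_nat n / rat_of_nat m = rat_of_int k"
  then obtain k :: int where k: "odd k" "rat_of_nat n / rat_of_nat m = rat_of_int k"
    by blast
  have "0 \<le> rat_of_int k"
    unfolding k(2)[symmetric] by simp
  then obtain l where l: "k = int l"
    by (metis nonneg_int_cases of_int_0_le_iff)
  have "rat_of_nat n = rat_of_nat (m * l)"
    using k(2) assms by (simp add: l field_simps)
  then have "n = m * l"
    by (simp only: of_nat_eq_iff)
  moreover obtain q where "l = 2 * q + 1"
    using k(1) l by (auto elim: oddE)
  ultimately have "n = m + 2 * m * q"
    by (simp add: algebra_simps)
  then show "n mod (2 * m) = m"
    using assms by simp
next
  assume "n mod (2 * m) = m"
  then have "n = m * (2 * (n div (2 * m)) + 1)"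
    using mult_div_mod_eq[of "2 * m" n] by (simp add: algebra_simps)
  then obtain q where "n = m * (2 * q + 1)"
    by blast
  then show "\<exists>k :: int. odd k \<and> rat_of_nat n / rat_of_nat m = rat_of_int k"
    using assms by (intro exI[of _ "2 * int q + 1"]) (simp add: field_simps)
qed

theorem theorem2:
  fixes m n r s :: nat
  assumes "m \<ge> 1" and "n \<ge> 1" and "r = 2 ^ m" and "s = 2 ^ n"
  shows "BC_compatible r s \<longleftrightarrow>
    m > 1 \<and> \<not> (\<exists>k :: int. odd k \<and> rat_of_nat n / rat_of_nat m = rat_of_int k)"
  using BC_compatible_iff_mod[OF assms] odd_quotient_iff_mod[OF assms(1)] by blast

end
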